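(* Any projection $P\in\mathbb{K}^{m\times m}$ can be written in the form $P=A(B^*A)^+B^*$ for some matrices $A\in\mathbb{K}^{m\times p}$, $B\in\mathbb{K}^{m\times q}$. Moreover, whenever $P=A(B^*A)^+B^*$, the complementary projection $I-P$ is given by \[I-P=C(DC)^+D,\] where \[C=I-(BB^*A)(BB^*A)^+,\qquad D=I-(AA^*B)(AA^*B)^+.\]
   Context: $\mathbb{K}=\mathbb{R}$ or $\mathbb{K}=\mathbb{C}$; $M^*$ is the conjugate transpose and $M^+$ the Moore--Penrose pseudoinverse of a matrix $M$; $I$ is the $m\times m$ identity matrix. A projection is a square matrix $P$ with $P^2=P$ (not necessarily Hermitian). *)

theory Defs
  imports "Jordan_Normal_Form.Schur_Decomposition"
begin

definition projection_mat :: "'a::semiring_0 mat \<Rightarrow> bool"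
  where "projection_mat P \<longleftrightarrow> square_mat P \<and> P * P = P"

(* The four Penrose conditions.  mat_adjoint is the conjugate transpose; on real
   matrices it is the transpose, since conjugate is the identity there. *)
definition is_moore_penrose :: "'a::conjugatable_field mat \<Rightarrow> 'a mat \<Rightarrow> bool"
  where "is_moore_penrose M X \<longleftrightarrow>
    X \<in> carrier_mat (dim_col M) (dim_row M) \<and>
    M * X * M = M \<and>
    X * M * X = X \<and>
    mat_adjoint (M * X) = M * X \<and>
    mat_adjoint (X * M) = X * M"

definition pseudoinverse :: "'a::conjugatable_field mat \<Rightarrow> 'a mat"
  where "pseudoinverse M = (THE X. is_moore_penrose M X)"

lemma mat_adjoint_carrier:
  assumes "A \<in> carrier_mat n k"
  shows "mat_adjoint A \<in> carrier_mat k n"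
  using assms unfolding mat_adjoint_def by auto

lemma mat_adjoint_index:
  assumes "A \<in> carrier_mat n k" "i < k" "j < n"
  shows "mat_adjoint A $$ (i, j) = conjugate (A $$ (j, i))"
  using assms unfolding mat_adjoint_def by (auto simp: mat_of_rows_index)

lemma mat_adjoint_mult:
  fixes A B :: "'a::conjugatable_field mat"
  assumes A: "A \<in> carrier_mat n k" and B: "B \<in> carrier_mat k l"
  shows "mat_adjoint (A * B) = mat_adjoint B * mat_adjoint A"
proof (rule eq_matI)
  note AB = mult_carrier_mat[OF A B]
  note A' = mat_adjoint_carrier[OF A] and B' = mat_adjoint_carrier[OF B]
  note AB' = mat_adjoint_carrier[OF AB]
  show "dim_row (mat_adjoint (A * B)) = dim_row (mat_adjoint B * mat_adjoint A)"
    "dim_col (mat_adjoint (A * B)) = dim_col (mat_adjoint B * mat_adjoint A)"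
    using A' B' AB' by auto
  fix i j assume "i < dim_row (mat_adjoint B * mat_adjoint A)"
    "j < dim_col (mat_adjoint B * mat_adjoint A)"
  then have ij: "i < l" "j < n" using A' B' by auto
  have "mat_adjoint (A * B) $$ (i, j) = conjugate ((A * B) $$ (j, i))"
    using mat_adjoint_index[OF AB] ij by simp
  also have "\<dots> = (\<Sum>t<k. conjugate (A $$ (j, t)) * conjugate (B $$ (t, i)))"
    using A B ij
    by (simp add: scalar_prod_def sum_conjugate conjugate_dist_mul atLeast0LessThan)
  also have "\<dots> = (mat_adjoint B * mat_adjoint A) $$ (i, j)"
    using A' B' ij
    by (simp add: scalar_prod_def atLeast0LessThan mat_adjoint_index[OF A]
        mat_adjoint_index[OF B] mult.commute)
  finally show "mat_adjoint (A * B) $$ (i, j) = (mat_adjoint B * mat_adjoint A) $$ (i, j)" .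
qed

lemma is_moore_penrose_unique:
  fixes M :: "'a::conjugatable_field mat"
  assumes X: "is_moore_penrose M X" and Y: "is_moore_penrose M Y"
  shows "X = Y"
proof -
  obtain n k where M: "M \<in> carrier_mat n k" by auto
  have Xc: "X \<in> carrier_mat k n" and Yc: "Y \<in> carrier_mat k n"
    using X Y M by (auto simp: is_moore_penrose_def)
  note X' = X[unfolded is_moore_penrose_def] and Y' = Y[unfolded is_moore_penrose_def]
  have MX: "M * X \<in> carrier_mat n n" and MY: "M * Y \<in> carrier_mat n n"
    and XM: "X * M \<in> carrier_mat k k" and YM: "Y * M \<in> carrier_mat k k"
    using M Xc Yc by auto
  have "M * X = (M * Y * M) * X" using Y' by simp
  also have "\<dots> = (M * Y) * (M * X)" using assoc_mult_mat[OF MY M Xc] .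
  finally have 1: "M * X = (M * Y) * (M * X)" .
  have "M * Y = (M * X * M) * Y" using X' by simp
  also have "\<dots> = (M * X) * (M * Y)" using assoc_mult_mat[OF MX M Yc] .
  finally have "mat_adjoint (M * Y) = mat_adjoint ((M * X) * (M * Y))" by simp
  then have e1: "M * X = M * Y"
    using 1 X' Y' by (simp add: mat_adjoint_mult[OF MX MY])
  have "X * M = X * (M * Y * M)" using Y' by simp
  also have "\<dots> = (X * M) * (Y * M)"
    using assoc_mult_mat[OF Xc M YM] assoc_mult_mat[OF M Yc M] by simp
  finally have 2: "X * M = (X * M) * (Y * M)" .
  have "Y * M = Y * (M * X * M)" using X' by simp
  also have "\<dots> = (Y * M) * (X * M)"
    using assoc_mult_mat[OF Yc M XM] assoc_mult_mat[OF M Xc M] by simp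
  finally have "mat_adjoint (Y * M) = mat_adjoint ((Y * M) * (X * M))" by simp
  then have e2: "X * M = Y * M"
    using 2 X' Y' by (simp add: mat_adjoint_mult[OF YM XM])
  have "X = X * M * X" using X' by simp
  also have "\<dots> = Y * (M * X)" using e2 assoc_mult_mat[OF Yc M Xc] by simp
  also have "\<dots> = Y * M * Y" using e1 assoc_mult_mat[OF Yc M Yc] by simp
  also have "\<dots> = Y" using Y' by simp
  finally show ?thesis .
qed

lemma pseudoinverse_eqI:
  "is_moore_penrose M X \<Longrightarrow> pseudoinverse M = X"
  unfolding pseudoinverse_def by (blast intro: is_moore_penrose_unique)

end

theory Submission
  imports Defs
begin

text \<open>
  The complementary formula is a statement about ranges and kernels.  Put \<open>M = B\<^sup>* A\<close>,
  \<open>U = A A\<^sup>* B\<close>, \<open>V = B B\<^sup>* A\<close> and \<open>Q = I - P\<close>.  The Penrose conditions for \<open>M\<close> say that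
  \<open>P = A M\<^sup>+ B\<^sup>*\<close> fixes \<open>U = A M\<^sup>*\<close> from the left and \<open>V\<^sup>* = M\<^sup>* B\<^sup>*\<close> from the right, and
  that it factors through both of them; so its range is that of \<open>U\<close> and its kernel is that of
  \<open>V\<^sup>*\<close>.  Consequently the orthogonal projection \<open>C = I - V V\<^sup>+\<close> maps onto the kernel of
  \<open>P\<close>, and \<open>D = I - U U\<^sup>+\<close> has the range of \<open>P\<close> as its kernel, which gives the relations
  \<open>Q C = C\<close>, \<open>C Q = Q\<close>, \<open>D Q = D\<close>, \<open>Q D = Q\<close>.  They make \<open>Q\<close> satisfy the Penrose
  conditions of \<open>D C\<close>: indeed \<open>(D C) Q = D\<close> and \<open>Q (D C) = C\<close> are Hermitian.  Hence
  \<open>(D C)\<^sup>+ = Q\<close> and \<open>C (D C)\<^sup>+ D = C Q D = Q\<close>.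

  A representation of a given projection is found with \<open>A = P P\<^sup>+\<close> and \<open>B = P\<^sup>*\<close>: then
  \<open>B\<^sup>* A = P P\<^sup>+\<close> is an orthogonal projection, hence its own pseudoinverse.

  All of this needs pseudoinverses to exist.  Over any field a matrix has an inner inverse, by
  elimination of one row at a time; the positivity of \<open>a \<cdot> conjugate a\<close> turns inner inverses of
  \<open>M\<^sup>* M\<close> and \<open>M M\<^sup>*\<close> into the Moore--Penrose inverse of \<open>M\<close>.
\<close>

section \<open>Matrix arithmetic with dimension side conditions\<close>

text \<open>With premises about dimensions instead of carriers, the simplifier can discharge them
  without guessing the sizes of the intermediate factors.\<close>

text \<open>The default rule would undo reassociation to the left, which several proofs need.\<close>

declare assoc_mult_mat [simp del]

lemma mult_assoc_dim:
  fixes A B C :: "'a::semiring_0 mat"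
  assumes "dim_col A = dim_row B" "dim_col B = dim_row C"
  shows "A * B * C = A * (B * C)"
  using assms by (intro assoc_mult_mat) auto

lemma minus_mult_dim:
  fixes A B C :: "'a::ring mat"
  assumes "dim_row A = dim_row B" "dim_col A = dim_col B" "dim_col B = dim_row C"
  shows "(A - B) * C = A * C - B * C"
  using assms by (intro minus_mult_distrib_mat) auto

lemma mult_minus_dim:
  fixes A B C :: "'a::ring mat"
  assumes "dim_row B = dim_row C" "dim_col B = dim_col C" "dim_col A = dim_row C"
  shows "A * (B - C) = A * B - A * C"
  using assms by (intro mult_minus_distrib_mat) auto

lemma mult_add_dim:
  fixes A B C :: "'a::semiring_0 mat"
  assumes "dim_row B = dim_row C" "dim_col B = dim_col C" "dim_col A = dim_row C"
  shows "A * (B + C) = A * B + A * C"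
  using assms by (intro mult_add_distrib_mat) auto

lemma add_mult_dim:
  fixes A B C :: "'a::semiring_0 mat"
  assumes "dim_row A = dim_row B" "dim_col A = dim_col B" "dim_col B = dim_row C"
  shows "(A + B) * C = A * C + B * C"
  using assms by (intro add_mult_distrib_mat) auto

lemma minus_zero_mat:
  fixes A :: "'a::group_add mat"
  assumes "A \<in> carrier_mat n k"
  shows "A - 0\<^sub>m n k = A"
  using assms by (intro eq_matI) auto

lemma dim_mat_adjoint [simp]:
  "dim_row (mat_adjoint A) = dim_col A" "dim_col (mat_adjoint A) = dim_row A"
  by (auto simp: mat_adjoint_def)

lemma mat_adjoint_index_dim:
  assumes "i < dim_col A" "j < dim_row A"
  shows "mat_adjoint A $$ (i, j) = conjugate (A $$ (j, i))"
  using assms by (intro mat_adjoint_index) auto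

lemma mat_adjoint_mult_dim:
  fixes A B :: "'a::conjugatable_field mat"
  assumes "dim_col A = dim_row B"
  shows "mat_adjoint (A * B) = mat_adjoint B * mat_adjoint A"
  using assms by (intro mat_adjoint_mult) auto

lemma mat_adjoint_adjoint [simp]: "mat_adjoint (mat_adjoint A) = A"
  by (rule eq_matI) (auto simp: mat_adjoint_index_dim)

lemma conjugate_minus:
  fixes a b :: "'a::conjugatable_field"
  shows "conjugate (a - b) = conjugate a - conjugate b"
  using conjugate_dist_add[of a "- b"] by (simp add: conjugate_neg)

lemma mat_adjoint_minus:
  fixes A B :: "'a::conjugatable_field mat"
  assumes "dim_row A = dim_row B" "dim_col A = dim_col B"
  shows "mat_adjoint (A - B) = mat_adjoint A - mat_adjoint B"
  using assms by (intro eq_matI) (auto simp: mat_adjoint_index_dim conjugate_minus)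

lemma conjugate_one: "conjugate (1 :: 'a::conjugatable_field) = 1"
proof -
  have "conjugate (1::'a) * conjugate 1 = conjugate 1 * 1"
    using conjugate_dist_mul[of "1::'a" 1] by simp
  then show ?thesis
    by (metis conjugate_zero_iff mult_cancel_left one_neq_zero)
qed

lemma mat_adjoint_one: "mat_adjoint (1\<^sub>m n :: 'a::conjugatable_field mat) = 1\<^sub>m n"
  by (rule eq_matI) (auto simp: mat_adjoint_index_dim conjugate_one)

section \<open>Inner inverses\<close>

text \<open>McCoy's lemma from the theory of von Neumann regular rings: a defect \<open>A - A X A\<close> of an
  approximate inner inverse \<open>X\<close> can be corrected as soon as it has an inner inverse itself.\<close>

lemma inner_inverse_from_defect:
  fixes A X Y :: "'a::ring_1 mat"
  assumes A: "A \<in> carrier_mat n k" and X: "X \<in> carrier_mat k n" and Y: "Y \<in> carrier_mat k n"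
    and Y_inner: "(A - A * X * A) * Y * (A - A * X * A) = A - A * X * A"
  shows "\<exists>Z \<in> carrier_mat k n. A * Z * A = A"
proof -
  define Z where "Z = X + (1\<^sub>m k - X * A) * Y * (1\<^sub>m n - A * X)"
  have Z: "Z \<in> carrier_mat k n"
    unfolding Z_def using A X Y by (intro carrier_matI) auto
  have l: "A * (1\<^sub>m k - X * A) = A - A * X * A" and r: "(1\<^sub>m n - A * X) * A = A - A * X * A"
    using A X by (simp_all add: minus_mult_dim mult_minus_dim mult_assoc_dim)
  have "A * Z * A = A * X * A + A * ((1\<^sub>m k - X * A) * Y * (1\<^sub>m n - A * X)) * A"
    using A X Y by (simp add: Z_def mult_add_dim add_mult_dim)
  also have "A * ((1\<^sub>m k - X * A) * Y * (1\<^sub>m n - A * X)) * A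
      = (A * (1\<^sub>m k - X * A)) * Y * ((1\<^sub>m n - A * X) * A)"
    using A X Y by (simp add: mult_assoc_dim)
  also have "\<dots> = A - A * X * A"
    unfolding l r by (rule Y_inner)
  also have "A * X * A + (A - A * X * A) = A"
    using A X by (intro eq_matI) auto
  finally show ?thesis using Z by blast
qed

text \<open>Subtracting the rank-one matrix through a nonzero entry at \<open>(i, j)\<close> clears row \<open>i\<close> and
  leaves the vanishing rows zero.  That matrix is \<open>A X A\<close> for the \<open>X\<close> with the single
  entry \<open>1 / A\<^sub>i\<^sub>j\<close> at \<open>(j, i)\<close>, so the defect lemma drives an induction on the number of
  nonzero rows.\<close>

lemma ex_inner_inverse:
  fixes A :: "'a::field mat"
  assumes "A \<in> carrier_mat n k"
  shows "\<exists>X \<in> carrier_mat k n. A * X * A = A"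
  using assms
proof (induction "card {r. r < n \<and> (\<exists>s<k. A $$ (r, s) \<noteq> 0)}" arbitrary: A rule: less_induct)
  case less
  note A = less.prems
  show ?case
  proof (cases "\<exists>i<n. \<exists>j<k. A $$ (i, j) \<noteq> 0")
    case False
    then have "A * 0\<^sub>m k n * A = A"
      using A by (intro eq_matI) auto
    then show ?thesis by (intro bexI[of _ "0\<^sub>m k n"]) auto
  next
    case True
    then obtain i j where ij: "i < n" "j < k" and pivot: "A $$ (i, j) \<noteq> 0" by blast
    define X where "X = mat k n (\<lambda>(s, r). if s = j \<and> r = i then 1 / A $$ (i, j) else 0)"
    have X: "X \<in> carrier_mat k n" by (simp add: X_def)
    define A' where "A' = A - A * X * A"
    have A': "A' \<in> carrier_mat n k" unfolding A'_def using A X by (intro carrier_matI) auto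
    have AX: "(A * X) $$ (r, t) = (if t = i then A $$ (r, j) / A $$ (i, j) else 0)"
      if "r < n" "t < n" for r t
    proof -
      have "(A * X) $$ (r, t) = (\<Sum>s<k. A $$ (r, s) * X $$ (s, t))"
        using A X that by (simp add: scalar_prod_def atLeast0LessThan)
      also have "\<dots> = (\<Sum>s<k. if s = j then A $$ (r, j) * X $$ (j, t) else 0)"
        using that ij by (intro sum.cong) (auto simp: X_def)
      finally show ?thesis using ij that by (simp add: X_def)
    qed
    have AXA: "(A * X * A) $$ (r, s) = A $$ (r, j) / A $$ (i, j) * A $$ (i, s)"
      if "r < n" "s < k" for r s
    proof -
      have "(A * X * A) $$ (r, s) = (\<Sum>t<n. (A * X) $$ (r, t) * A $$ (t, s))"
        using A X that
        by (simp add: scalar_prod_def atLeast0LessThan)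
      also have "\<dots> = (\<Sum>t<n. if t = i then A $$ (r, j) / A $$ (i, j) * A $$ (i, s) else 0)"
        using that by (intro sum.cong) (auto simp: AX simp del: index_mult_mat)
      finally show ?thesis using ij by simp
    qed
    have A'_entry: "A' $$ (r, s) = A $$ (r, s) - A $$ (r, j) / A $$ (i, j) * A $$ (i, s)"
      if "r < n" "s < k" for r s
      using that A X AXA[OF that] by (simp add: A'_def)
    have "{r. r < n \<and> (\<exists>s<k. A' $$ (r, s) \<noteq> 0)} \<subset> {r. r < n \<and> (\<exists>s<k. A $$ (r, s) \<noteq> 0)}"
    proof (rule psubsetI)
      show "{r. r < n \<and> (\<exists>s<k. A' $$ (r, s) \<noteq> 0)} \<subseteq> {r. r < n \<and> (\<exists>s<k. A $$ (r, s) \<noteq> 0)}"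
        using ij by (auto simp: A'_entry) (metis div_0 mult_zero_left)
      have "i \<in> {r. r < n \<and> (\<exists>s<k. A $$ (r, s) \<noteq> 0)}"
        "i \<notin> {r. r < n \<and> (\<exists>s<k. A' $$ (r, s) \<noteq> 0)}"
        using ij pivot by (auto simp: A'_entry)
      then show "{r. r < n \<and> (\<exists>s<k. A' $$ (r, s) \<noteq> 0)} \<noteq> {r. r < n \<and> (\<exists>s<k. A $$ (r, s) \<noteq> 0)}"
        by blast
    qed
    then have "card {r. r < n \<and> (\<exists>s<k. A' $$ (r, s) \<noteq> 0)}
        < card {r. r < n \<and> (\<exists>s<k. A $$ (r, s) \<noteq> 0)}"
      by (intro psubset_card_mono) auto
    from less.hyps[OF this A'] obtain Y where "Y \<in> carrier_mat k n" "A' * Y * A' = A'" by blast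
    then show ?thesis
      using inner_inverse_from_defect[OF A X] by (auto simp: A'_def)
  qed
qed

section \<open>Existence of the Moore--Penrose inverse\<close>

text \<open>The diagonal of \<open>N\<^sup>* N\<close> consists of the squared norms of the columns of \<open>N\<close>, and a
  vector of norm zero vanishes by the positivity of the conjugation.\<close>

lemma adjoint_mult_self_eq_0:
  fixes N :: "'a::conjugatable_ordered_field mat"
  assumes N: "N \<in> carrier_mat n k" and NN: "mat_adjoint N * N = 0\<^sub>m k k"
  shows "N = 0\<^sub>m n k"
proof (rule eq_matI)
  fix i j assume ij: "i < dim_row (0\<^sub>m n k :: 'a mat)" "j < dim_col (0\<^sub>m n k :: 'a mat)"
  have "col N j \<bullet>c col N j = (mat_adjoint N * N) $$ (j, j)"
    using N ij by (auto simp: scalar_prod_def mat_adjoint_index_dim mult.commute intro!: sum.cong)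
  also have "\<dots> = 0" using NN ij by simp
  finally have "col N j = 0\<^sub>v n"
    using N by (subst (asm) conjugate_square_eq_0_vec[of _ n]) auto
  then have "col N j $ i = 0" using ij by simp
  then show "N $$ (i, j) = 0\<^sub>m n k $$ (i, j)" using N ij by simp
qed (use N in auto)

text \<open>The orthogonal projection onto the range of \<open>M\<close> is \<open>M G M\<^sup>*\<close> for any inner inverse
  \<open>G\<close> of \<open>M\<^sup>* M\<close>.  It fixes \<open>M\<close> since the difference \<open>M (G M\<^sup>* M - I)\<close> lies both in the
  range of \<open>M\<close> and in the kernel of \<open>M\<^sup>*\<close>.\<close>

lemma ex_orthogonal_projection_onto_range:
  fixes M :: "'a::conjugatable_ordered_field mat"
  assumes M: "M \<in> carrier_mat n k"
  shows "\<exists>L \<in> carrier_mat k n. M * L * M = M \<and> mat_adjoint (M * L) = M * L"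
proof -
  let ?H = "mat_adjoint M * M"
  have H: "?H \<in> carrier_mat k k" using M by auto
  then obtain G where G: "G \<in> carrier_mat k k" and HGH: "?H * G * ?H = ?H"
    using ex_inner_inverse by blast
  define L where "L = G * mat_adjoint M"
  have L: "L \<in> carrier_mat k n" unfolding L_def using M G by (intro carrier_matI) auto
  define W where "W = L * M - 1\<^sub>m k"
  have W: "W \<in> carrier_mat k k" unfolding W_def using L M by (intro carrier_matI) auto
  have MW: "M * W = M * L * M - M"
    using M L by (simp add: W_def mult_minus_dim mult_assoc_dim)
  have "mat_adjoint M * (M * W) = ?H * G * ?H - ?H"
    using M G by (simp add: MW L_def mult_minus_dim mult_assoc_dim)
  also have "\<dots> = 0\<^sub>m k k" using HGH M by auto
  finally have "mat_adjoint (M * W) * (M * W) = 0\<^sub>m k k"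
    using M W by (simp add: mat_adjoint_mult_dim mult_assoc_dim)
  then have "M * W = 0\<^sub>m n k"
    by (rule adjoint_mult_self_eq_0[rotated]) (use M W in auto)
  then have zero: "M * L * M - M = 0\<^sub>m n k" by (simp add: MW)
  have fixes_M: "M * L * M = M"
  proof (rule eq_matI)
    fix i j assume "i < dim_row M" "j < dim_col M"
    then show "(M * L * M) $$ (i, j) = M $$ (i, j)"
      using arg_cong[OF zero, of "\<lambda>Z. Z $$ (i, j)"] M L by simp
  qed (use M L in auto)
  \<comment> \<open>From \<open>M\<^sup>* = (M L M)\<^sup>*\<close> one gets \<open>M\<^sup>* E\<^sup>* = M\<^sup>*\<close> for \<open>E = M L = M G M\<^sup>*\<close>;
     multiplied by \<open>M G\<close> this reads \<open>E E\<^sup>* = E\<close>, so \<open>E\<close> is Hermitian.\<close>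
  have "mat_adjoint M * mat_adjoint (M * L) = mat_adjoint (M * L * M)"
    using M L by (intro mat_adjoint_mult_dim[symmetric]) auto
  also note fixes_M
  finally have "M * L * mat_adjoint (M * L) = M * L"
    using M L G by (simp add: L_def mult_assoc_dim)
  moreover have "mat_adjoint (M * L * mat_adjoint (M * L)) = M * L * mat_adjoint (M * L)"
    using M L by (subst mat_adjoint_mult_dim) auto
  ultimately have "mat_adjoint (M * L) = M * L" by simp
  with fixes_M L show ?thesis by blast
qed

text \<open>With the orthogonal projections \<open>E = M L\<close> onto the range of \<open>M\<close> and \<open>F = M\<^sup>* K\<close> onto
  that of \<open>M\<^sup>*\<close>, the matrix \<open>F L\<close> is the inverse sought: \<open>M (F L) = M L = E\<close>, and
  \<open>(F L) M = K\<^sup>* M L M = F\<close> because \<open>F = F\<^sup>* = K\<^sup>* M\<close>.\<close>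

lemma ex_moore_penrose:
  fixes M :: "'a::conjugatable_ordered_field mat"
  shows "\<exists>X. is_moore_penrose M X"
proof -
  obtain n k where M: "M \<in> carrier_mat n k" by auto
  obtain L where L: "L \<in> carrier_mat k n" and MLM: "M * L * M = M"
    and E: "mat_adjoint (M * L) = M * L"
    using ex_orthogonal_projection_onto_range[OF M] by blast
  obtain K where K: "K \<in> carrier_mat n k"
    and MKM: "mat_adjoint M * K * mat_adjoint M = mat_adjoint M"
    and F: "mat_adjoint (mat_adjoint M * K) = mat_adjoint M * K"
    using ex_orthogonal_projection_onto_range[OF mat_adjoint_carrier[OF M]] by blast
  define F where "F = mat_adjoint M * K"
  have Fc: "F \<in> carrier_mat k k" unfolding F_def using M K by (intro carrier_matI) auto
  have F_adj: "mat_adjoint F = F" using F by (simp add: F_def)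
  have F_eq: "F = mat_adjoint K * M"
    using F_adj M K by (simp add: F_def mat_adjoint_mult_dim)
  have "mat_adjoint (F * mat_adjoint M) = M"
    using MKM by (simp add: F_def)
  then have MF: "M * F = M" using M Fc by (simp add: mat_adjoint_mult_dim F_adj)
  have FF: "F * F = F"
    using F_eq MF M K Fc by (metis assoc_mult_mat mat_adjoint_carrier)
  define X where "X = F * L"
  have X: "X \<in> carrier_mat k n" using Fc L by (simp add: X_def)
  have MX: "M * X = M * L"
    using M L Fc MF by (simp add: X_def flip: mult_assoc_dim)
  have "X * M = mat_adjoint K * (M * L * M)"
    using M L K Fc by (simp add: X_def F_eq mult_assoc_dim)
  then have XM: "X * M = F" by (simp add: MLM F_eq)
  have "X * M * X = F * F * L"
    unfolding XM unfolding X_def using Fc L by (simp add: mult_assoc_dim)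
  then have "X * M * X = X" by (simp add: FF X_def)
  moreover have "X \<in> carrier_mat (dim_col M) (dim_row M)" using X M by auto
  ultimately have "is_moore_penrose M X"
    by (simp add: is_moore_penrose_def MX XM MLM E F_adj)
  then show ?thesis by blast
qed

lemma is_moore_penrose_pseudoinverse:
  fixes M :: "'a::conjugatable_ordered_field mat"
  shows "is_moore_penrose M (pseudoinverse M)"
  using ex_moore_penrose[of M] pseudoinverse_eqI by auto

lemma pseudoinverse_dim [simp]:
  fixes M :: "'a::conjugatable_ordered_field mat"
  shows "dim_row (pseudoinverse M) = dim_col M" "dim_col (pseudoinverse M) = dim_row M"
  using is_moore_penrose_pseudoinverse[of M] by (auto simp: is_moore_penrose_def)

lemma penrose_conditions:
  fixes M :: "'a::conjugatable_ordered_field mat"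
  shows "M * pseudoinverse M * M = M"
    and "pseudoinverse M * M * pseudoinverse M = pseudoinverse M"
    and "mat_adjoint (M * pseudoinverse M) = M * pseudoinverse M"
    and "mat_adjoint (pseudoinverse M * M) = pseudoinverse M * M"
  using is_moore_penrose_pseudoinverse[of M] by (auto simp: is_moore_penrose_def)

lemma pseudoinverse_orthogonal_projection:
  fixes E :: "'a::conjugatable_field mat"
  assumes "E \<in> carrier_mat n n" "E * E = E" "mat_adjoint E = E"
  shows "pseudoinverse E = E"
  using assms by (intro pseudoinverse_eqI) (auto simp: is_moore_penrose_def)

section \<open>The two halves of the theorem\<close>

text \<open>The number of columns of the two factors has to be positive, which excludes the choice
  \<open>A = P P\<^sup>+\<close>, \<open>B = P\<^sup>*\<close> for the empty matrix \<open>P\<close>; there any factors do.\<close>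

lemma ex_oblique_representation:
  fixes P :: "'a::conjugatable_ordered_field mat"
  assumes "P \<in> carrier_mat m m \<and> projection_mat P"
  shows "\<exists>p q A B. 0 < p \<and> 0 < q \<and> A \<in> carrier_mat m p \<and> B \<in> carrier_mat m q \<and>
    P = A * pseudoinverse (mat_adjoint B * A) * mat_adjoint B"
proof (cases "m = 0")
  case True
  let ?Z = "0\<^sub>m 0 1 :: 'a mat"
  have "P = ?Z * pseudoinverse (mat_adjoint ?Z * ?Z) * mat_adjoint ?Z"
    using assms True by (intro eq_matI) auto
  then show ?thesis
    using True by (intro exI[of _ "1::nat"] exI[of _ ?Z]) simp
next
  case False
  have P: "P \<in> carrier_mat m m" and PP: "P * P = P"
    using assms by (auto simp: projection_mat_def)
  let ?E = "P * pseudoinverse P"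
  have E: "?E \<in> carrier_mat m m" using P by (intro carrier_matI) auto
  have PE: "P * ?E = ?E" using P PP by (simp flip: mult_assoc_dim)
  have "?E * ?E = ?E * P * pseudoinverse P"
    using P by (simp add: mult_assoc_dim)
  then have EE: "?E * ?E = ?E" by (simp add: penrose_conditions)
  have "pseudoinverse ?E = ?E"
    by (rule pseudoinverse_orthogonal_projection[OF E EE penrose_conditions(3)])
  then have "?E * pseudoinverse (mat_adjoint (mat_adjoint P) * ?E) * mat_adjoint (mat_adjoint P)
      = ?E * ?E * P"
    by (simp add: PE)
  also have "\<dots> = P" by (simp only: EE penrose_conditions)
  finally show ?thesis using E mat_adjoint_carrier[OF P] False by (metis gr0I)
qed

text \<open>\<open>I - V V\<^sup>+\<close> is the orthogonal projection along the range of \<open>V\<close>; it fixes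
  whatever \<open>V\<^sup>*\<close> annihilates because \<open>V V\<^sup>+ = (V\<^sup>+)\<^sup>* V\<^sup>*\<close>.\<close>

lemma range_complement_projection:
  fixes V :: "'a::conjugatable_ordered_field mat"
  assumes V: "V \<in> carrier_mat m k" and C: "C = 1\<^sub>m m - V * pseudoinverse V"
  shows "C \<in> carrier_mat m m" "mat_adjoint C = C" "C * V = 0\<^sub>m m k" "mat_adjoint V * C = 0\<^sub>m k m"
    and "X \<in> carrier_mat m l \<Longrightarrow> mat_adjoint V * X = 0\<^sub>m k l \<Longrightarrow> C * X = X"
proof -
  let ?E = "V * pseudoinverse V"
  show Cc: "C \<in> carrier_mat m m" unfolding C using V by (intro carrier_matI) auto
  show C_adj: "mat_adjoint C = C"
    using V by (simp add: C mat_adjoint_minus mat_adjoint_one penrose_conditions)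
  show CV: "C * V = 0\<^sub>m m k"
    using V by (simp add: C minus_mult_dim penrose_conditions)
  have "mat_adjoint V * mat_adjoint C = mat_adjoint (C * V)"
    using V Cc by (intro mat_adjoint_mult_dim[symmetric]) auto
  also have "\<dots> = 0\<^sub>m k m"
    unfolding CV by (intro eq_matI) (auto simp: mat_adjoint_index_dim)
  finally show "mat_adjoint V * C = 0\<^sub>m k m" by (simp add: C_adj)
  show "C * X = X" if X: "X \<in> carrier_mat m l" and VX: "mat_adjoint V * X = 0\<^sub>m k l"
  proof -
    have "?E * X = mat_adjoint ?E * X" by (simp only: penrose_conditions)
    also have "\<dots> = mat_adjoint (pseudoinverse V) * (mat_adjoint V * X)"
      using V X by (simp add: mat_adjoint_mult_dim mult_assoc_dim)
    also have "\<dots> = 0\<^sub>m m l" using V unfolding VX by simp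
    finally show ?thesis using X V by (simp add: C minus_mult_dim minus_zero_mat)
  qed
qed

text \<open>An oblique projection is determined by its range and kernel; in terms of the orthogonal
  projections \<open>C\<close> onto the range and \<open>D\<close> along the kernel it is the pseudoinverse
  of \<open>D C\<close>, since the two products are the Hermitian matrices \<open>(D C) Q = D\<close> and
  \<open>Q (D C) = C\<close>.\<close>

lemma oblique_projection_eq:
  fixes Q C D :: "'a::conjugatable_field mat"
  assumes Q: "Q \<in> carrier_mat m m" and C: "C \<in> carrier_mat m m" and D: "D \<in> carrier_mat m m"
    and C_adj: "mat_adjoint C = C" and D_adj: "mat_adjoint D = D"
    and QC: "Q * C = C" and CQ: "C * Q = Q" and DQ: "D * Q = D" and QD: "Q * D = Q"
  shows "Q = C * pseudoinverse (D * C) * D"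
proof -
  have "D * Q * D = D * (Q * D)" using Q D by (intro mult_assoc_dim) auto
  then have DD: "D * D = D" by (simp only: DQ QD)
  have DCQ: "D * C * Q = D" using Q C D CQ DQ by (simp add: mult_assoc_dim)
  have QDC: "Q * (D * C) = C" using Q C D QC QD by (simp flip: mult_assoc_dim)
  have "D * C * Q * (D * C) = D * C"
    unfolding DCQ using D C DD by (simp flip: mult_assoc_dim)
  then have "is_moore_penrose (D * C) Q"
    using Q C D by (simp add: is_moore_penrose_def DCQ QDC CQ C_adj D_adj carrier_matD)
  then have "pseudoinverse (D * C) = Q" by (rule pseudoinverse_eqI)
  then show ?thesis by (simp add: CQ QD)
qed

text \<open>The factorisations \<open>M\<^sup>+ = M\<^sup>* (M\<^sup>+)\<^sup>* M\<^sup>+ = M\<^sup>+ (M\<^sup>+)\<^sup>* M\<^sup>*\<close> bring \<open>U = A M\<^sup>*\<close> and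
  \<open>V\<^sup>* = M\<^sup>* B\<^sup>*\<close> into \<open>P = A M\<^sup>+ B\<^sup>*\<close>, and
  conversely \<open>P U = U\<close> and \<open>V\<^sup>* P = V\<^sup>*\<close>.  Hence \<open>P\<close> has the range of \<open>U\<close>, which is the
  kernel of \<open>D\<close>, and the kernel of \<open>V\<^sup>*\<close>, which is the range of \<open>C\<close>.\<close>

lemma complementary_projection_formula:
  fixes P A B :: "'a::conjugatable_ordered_field mat"
  assumes "A \<in> carrier_mat m p \<and> B \<in> carrier_mat m q \<and>
    P = A * pseudoinverse (mat_adjoint B * A) * mat_adjoint B \<and>
    C = 1\<^sub>m m - (B * mat_adjoint B * A) * pseudoinverse (B * mat_adjoint B * A) \<and>
    D = 1\<^sub>m m - (A * mat_adjoint A * B) * pseudoinverse (A * mat_adjoint A * B)"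
  shows "1\<^sub>m m - P = C * pseudoinverse (D * C) * D"
proof -
  define M where "M = mat_adjoint B * A"
  define G where "G = pseudoinverse M"
  define U where "U = A * mat_adjoint A * B"
  define V where "V = B * mat_adjoint B * A"
  have A: "A \<in> carrier_mat m p" and B: "B \<in> carrier_mat m q"
    and P_eq: "P = A * G * mat_adjoint B"
    and C_eq: "C = 1\<^sub>m m - V * pseudoinverse V" and D_eq: "D = 1\<^sub>m m - U * pseudoinverse U"
    using assms by (auto simp: M_def G_def U_def V_def)
  note carr [simp] = carrier_matD[OF A] carrier_matD[OF B]
  have M_dim [simp]: "dim_row M = q" "dim_col M = p" by (simp_all add: M_def)
  have G_dim [simp]: "dim_row G = p" "dim_col G = q" by (simp_all add: G_def)
  have P: "P \<in> carrier_mat m m" by (intro carrier_matI) (simp_all add: P_eq)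
  note P_dim [simp] = carrier_matD[OF P]
  have U: "U \<in> carrier_mat m q" by (intro carrier_matI) (simp_all add: U_def)
  have V: "V \<in> carrier_mat m p" by (intro carrier_matI) (simp_all add: V_def)
  have M_adj: "mat_adjoint M = mat_adjoint A * B" by (simp add: M_def mat_adjoint_mult_dim)
  have U_eq: "U = A * mat_adjoint M" by (simp add: U_def M_adj mult_assoc_dim)
  have V_adj: "mat_adjoint V = mat_adjoint M * mat_adjoint B"
    by (simp add: V_def M_adj mat_adjoint_mult_dim mult_assoc_dim)
  note penrose = penrose_conditions[of M, folded G_def]

  have GMM: "G * M * mat_adjoint M = mat_adjoint M"
  proof -
    have "mat_adjoint (M * (G * M)) = mat_adjoint (G * M) * mat_adjoint M"
      by (simp add: mat_adjoint_mult_dim)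
    moreover have "M * (G * M) = M" using penrose(1) by (simp add: mult_assoc_dim)
    ultimately show ?thesis by (simp only: penrose(4))
  qed
  have MMG: "mat_adjoint M * (M * G) = mat_adjoint M"
  proof -
    have "mat_adjoint (M * G * M) = mat_adjoint M * mat_adjoint (M * G)"
      by (simp add: mat_adjoint_mult_dim)
    then show ?thesis by (simp only: penrose)
  qed
  have G_left: "G = mat_adjoint M * (mat_adjoint G * G)"
  proof -
    have "G = mat_adjoint (G * M) * G" by (simp only: penrose)
    then show ?thesis by (simp add: mat_adjoint_mult_dim mult_assoc_dim)
  qed
  have G_right: "G = G * mat_adjoint G * mat_adjoint M"
  proof -
    have "G = G * mat_adjoint (M * G)"
      using penrose(2) by (simp add: penrose(3)) (simp add: mult_assoc_dim)
    then show ?thesis by (simp add: mat_adjoint_mult_dim mult_assoc_dim)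
  qed

  have PU: "P * U = U"
  proof -
    have "P * U = A * (G * M * mat_adjoint M)"
      by (simp add: P_eq U_eq M_def mult_assoc_dim)
    then show ?thesis by (simp add: GMM U_eq)
  qed
  have VP: "mat_adjoint V * P = mat_adjoint V"
  proof -
    have "mat_adjoint V * P = mat_adjoint M * (M * G) * mat_adjoint B"
      by (simp add: P_eq V_adj M_def mult_assoc_dim)
    then show ?thesis by (simp add: MMG V_adj)
  qed
  have P_left: "P = U * (mat_adjoint G * G * mat_adjoint B)"
    unfolding P_eq U_eq by (subst G_left) (simp add: mult_assoc_dim)
  have P_right: "P = A * G * mat_adjoint G * mat_adjoint V"
    unfolding P_eq V_adj by (subst G_right) (simp add: mult_assoc_dim)

  note C_props = range_complement_projection[OF V C_eq]
  note D_props = range_complement_projection[OF U D_eq]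
  note CD_dim [simp] = carrier_matD[OF C_props(1)] carrier_matD[OF D_props(1)]
    carrier_matD[OF U] carrier_matD[OF V]
  define Q where "Q = 1\<^sub>m m - P"
  have Q: "Q \<in> carrier_mat m m" unfolding Q_def using P by (intro carrier_matI) auto
  note Q_dim [simp] = carrier_matD[OF Q]
  have "P * C = A * G * mat_adjoint G * (mat_adjoint V * C)"
    by (subst P_right) (simp add: mult_assoc_dim)
  then have "P * C = 0\<^sub>m m m" by (simp add: C_props(4))
  then have QC: "Q * C = C"
    using C_props(1) by (simp add: Q_def minus_mult_dim minus_zero_mat)
  have "mat_adjoint V * Q = 0\<^sub>m p m"
    using V by (simp add: Q_def mult_minus_dim VP minus_r_inv_mat[OF mat_adjoint_carrier[OF V]])
  then have CQ: "C * Q = Q" by (rule C_props(5)[OF Q])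
  have "D * P = D * U * (mat_adjoint G * G * mat_adjoint B)"
    by (subst P_left) (simp add: mult_assoc_dim)
  then have "D * P = 0\<^sub>m m m" by (simp add: D_props(3))
  then have DQ: "D * Q = D"
    using D_props(1) by (simp add: Q_def mult_minus_dim minus_zero_mat)
  have QU: "Q * U = 0\<^sub>m m q" using U by (simp add: Q_def minus_mult_dim PU)
  have "Q * D = Q - Q * U * pseudoinverse U"
    using Q by (simp add: D_eq mult_minus_dim mult_assoc_dim)
  then have QD: "Q * D = Q" using Q by (simp add: QU minus_zero_mat)
  show ?thesis
    using oblique_projection_eq[OF Q C_props(1) D_props(1) C_props(2) D_props(2)
        QC CQ DQ QD]
    by (simp add: Q_def)
qed

theorem corollary4p8:
  shows "(\<forall>(m::nat) (P::real mat).
          P \<in> carrier_mat m m \<and> projection_mat P \<longrightarrow>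
          (\<exists>p q A B. 0 < p \<and> 0 < q \<and>
             A \<in> carrier_mat m p \<and> B \<in> carrier_mat m q \<and>
             P = A * pseudoinverse (mat_adjoint B * A) * mat_adjoint B) \<and>
          (\<forall>p q A B C D.
             A \<in> carrier_mat m p \<and> B \<in> carrier_mat m q \<and>
             P = A * pseudoinverse (mat_adjoint B * A) * mat_adjoint B \<and>
             C = 1\<^sub>m m - (B * mat_adjoint B * A) * pseudoinverse (B * mat_adjoint B * A) \<and>
             D = 1\<^sub>m m - (A * mat_adjoint A * B) * pseudoinverse (A * mat_adjoint A * B) \<longrightarrow>
             1\<^sub>m m - P = C * pseudoinverse (D * C) * D))
       \<and> (\<forall>(m::nat) (P::complex mat).
          P \<in> carrier_mat m m \<and> projection_mat P \<longrightarrow>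
          (\<exists>p q A B. 0 < p \<and> 0 < q \<and>
             A \<in> carrier_mat m p \<and> B \<in> carrier_mat m q \<and>
             P = A * pseudoinverse (mat_adjoint B * A) * mat_adjoint B) \<and>
          (\<forall>p q A B C D.
             A \<in> carrier_mat m p \<and> B \<in> carrier_mat m q \<and>
             P = A * pseudoinverse (mat_adjoint B * A) * mat_adjoint B \<and>
             C = 1\<^sub>m m - (B * mat_adjoint B * A) * pseudoinverse (B * mat_adjoint B * A) \<and>
             D = 1\<^sub>m m - (A * mat_adjoint A * B) * pseudoinverse (A * mat_adjoint A * B) \<longrightarrow>
             1\<^sub>m m - P = C * pseudoinverse (D * C) * D))"
  by (intro conjI allI impI; rule ex_oblique_representation complementary_projection_formula; assumption)

end
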